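(* Let $n,k$ be integers with $1\le k\le \lfloor n/2\rfloor$, and let $\mathcal{O}(n,k)$ be the set of trees of order $n$ having exactly $2k$ odd vertices. If $T\in\mathcal{O}(n,k)$ has maximum Mostar index among all trees in $\mathcal{O}(n,k)$, then $T\cong S_{n,2k}$, where in the case $k=n/2$ we set $S_{n,n}=S_n$.
   Context: For a connected simple graph $G$, the Mostar index is $Mo(G)=\sum_{uv\in E(G)}|n_u-n_v|$, where for an edge $e=uv$, $n_u$ is the number of vertices of $G$ closer (in graph distance) to $u$ than to $v$, and $n_v$ is the number of vertices closer to $v$ than to $u$. The order of a graph is its number of vertices. A vertex is odd if its degree is odd. $S_n$ and $P_n$ denote the star and the path on $n$ vertices. For $3\le r\le n-2$, $S_{n,r}$ is the $n$-vertex tree consisting of $r$ pendent paths attached at a common vertex (i.e. a spider with $r$ legs), of which $t$ have length $\lfloor\frac{n-1}{r}\rfloor+1$ and $r-t$ have length $\lfloor\frac{n-1}{r}\rfloor$, where $t=n-1-r\lfloor\frac{n-1}{r}\rfloor$ (length = number of edges). Also $S_{n,n-1}=S_n$ and $S_{n,2}=P_n$. *)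

theory Defs
  imports "Graph_Theory.Graph_Theory"
begin

text \<open>
  Finite simple graphs are the symmetric loopfree digraphs \<open>pair_graph\<close> of Graph_Theory:
  an edge \<open>uv\<close> is the pair of arcs \<open>(u, v)\<close>, \<open>(v, u)\<close>.  The predicate \<open>tree\<close> of
  that library is not usable here: it counts \<open>u, v, u\<close> as a cycle, so that no symmetric
  digraph with an arc satisfies it.  A cycle of a simple graph is a library cycle with at least
  three arcs.
\<close>

definition simple_tree :: "'a pair_pre_digraph \<Rightarrow> bool" where
  "simple_tree G \<longleftrightarrow> pair_graph G \<and> Digraph_Component.connected (with_proj G) \<and>
     \<not> (\<exists>p. pre_digraph.cycle (with_proj G) p \<and> length p \<ge> 3)"

definition graph_edges :: "'a pair_pre_digraph \<Rightarrow> 'a set set" where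
  "graph_edges G = {{u, v} | u v. (u, v) \<in> parcs G}"

definition graph_dist :: "'a pair_pre_digraph \<Rightarrow> 'a \<Rightarrow> 'a \<Rightarrow> ereal" where
  "graph_dist G u v = wf_digraph.\<mu> (with_proj G) (\<lambda>_. 1) u v"

definition n_closer :: "'a pair_pre_digraph \<Rightarrow> 'a \<Rightarrow> 'a \<Rightarrow> nat" where
  "n_closer G u v = card {w \<in> pverts G. graph_dist G w u < graph_dist G w v}"

text \<open>
  \<open>\<bar>n\<^sub>u - n\<^sub>v\<bar>\<close> for the unordered edge \<open>uv\<close>; by symmetry in \<open>u\<close> and \<open>v\<close> the description
  is unique, see \<open>edge_imbalance_doubleton\<close>.
\<close>

definition edge_imbalance :: "'a pair_pre_digraph \<Rightarrow> 'a set \<Rightarrow> int" where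
  "edge_imbalance G e =
     (THE d. \<exists>u v. e = {u, v} \<and> d = \<bar>int (n_closer G u v) - int (n_closer G v u)\<bar>)"

lemma edge_imbalance_doubleton:
  "edge_imbalance G {u, v} = \<bar>int (n_closer G u v) - int (n_closer G v u)\<bar>"
  unfolding edge_imbalance_def
  by (rule the_equality) (auto simp: doubleton_eq_iff)

definition mostar_index :: "'a pair_pre_digraph \<Rightarrow> int" where
  "mostar_index G = (\<Sum>e\<in>graph_edges G. edge_imbalance G e)"

definition odd_vertices :: "'a pair_pre_digraph \<Rightarrow> 'a set" where
  "odd_vertices G = {v \<in> pverts G. odd (out_degree (with_proj G) v)}"

definition odd_trees :: "nat \<Rightarrow> nat \<Rightarrow> 'a pair_pre_digraph set" where
  "odd_trees n k = {G. simple_tree G \<and> card (pverts G) = n \<and> card (odd_vertices G) = 2 * k}"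

text \<open>
  The tree consisting of \<open>r\<close> paths attached at a common vertex, the \<open>i\<close>-th one
  (\<open>i < r\<close>) having \<open>len i\<close> edges: \<open>spider_vertex i j\<close> is the vertex of the \<open>i\<close>-th path
  at distance \<open>j\<close> from the common vertex \<open>(0, 0)\<close>.
\<close>

definition spider_vertex :: "nat \<Rightarrow> nat \<Rightarrow> nat \<times> nat" where
  "spider_vertex i j = (if j = 0 then (0, 0) else (i, j))"

definition spider :: "nat \<Rightarrow> (nat \<Rightarrow> nat) \<Rightarrow> (nat \<times> nat) pair_pre_digraph" where
  "spider r len =
     (let A = {(spider_vertex i j, spider_vertex i (Suc j)) | i j. i < r \<and> j < len i}
      in \<lparr> pverts = insert (0, 0) {spider_vertex i j | i j. i < r \<and> j \<le> len i},
           parcs = A \<union> A\<inverse> \<rparr>)"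

definition star_graph :: "nat \<Rightarrow> (nat \<times> nat) pair_pre_digraph" where
  "star_graph n = spider (n - 1) (\<lambda>_. 1)"

definition path_graph :: "nat \<Rightarrow> (nat \<times> nat) pair_pre_digraph" where
  "path_graph n = spider 1 (\<lambda>_. n - 1)"

text \<open>
  The tree \<open>S\<^bsub>n,r\<^esub>\<close>, meant for \<open>n \<ge> 2\<close> and \<open>2 \<le> r \<le> n\<close>.  The first two cases overlap for
  \<open>r = 2\<close>, \<open>n \<le> 3\<close>, where the star and the path are isomorphic.
\<close>

definition balanced_spider :: "nat \<Rightarrow> nat \<Rightarrow> (nat \<times> nat) pair_pre_digraph" where
  "balanced_spider n r =
     (if r = n \<or> r = n - 1 then star_graph n
      else if r = 2 then path_graph n
      else let q = (n - 1) div r; t = n - 1 - r * q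
           in spider r (\<lambda>i. if i < t then q + 1 else q))"

end

theory Submission
  imports Defs
begin

text \<open>
  Removing an edge \<open>uv\<close> of a tree of order \<open>n\<close> leaves components of sizes \<open>n\<^sub>u\<close> and
  \<open>n\<^sub>v = n - n\<^sub>u\<close>.  If the tree is rooted and \<open>v\<close> is a child of \<open>u\<close>, then
  \<open>\<bar>n\<^sub>u - n\<^sub>v\<bar> \<ge> n - 2 n\<^sub>v\<close>, and summing over the edges gives
  \<open>Mo \<ge> n (n - 1) - 2 D\<close>, where \<open>D\<close> is the sum of the distances to the root; equality holds when
  the root is a centroid.  So a maximal \<open>Mo\<close> means a minimal \<open>D\<close>.  Every level below the root
  has at most as many vertices as there are leaves, hence at most \<open>2 k\<close>, so at least
  \<open>n - 1 - 2 k d\<close> vertices have depth greater than \<open>d\<close>.  Summed over \<open>d\<close> this bounds \<open>D\<close> from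
  below, and equality forces all levels but the last to have exactly \<open>2 k\<close> vertices.  As there are
  no more than \<open>2 k\<close> leaves, no vertex below the root can branch then, and the tree is the balanced
  spider.
\<close>

section \<open>Rooted trees given by a parent function\<close>

text \<open>Every tree has this form (\<open>simple_tree_rooted\<close>), so that distances, degrees
  and cuts can be read off the iterates of \<open>par\<close>.\<close>

definition tree_graph :: "'a set \<Rightarrow> 'a \<Rightarrow> ('a \<Rightarrow> 'a) \<Rightarrow> 'a pair_pre_digraph" where
  "tree_graph V r par = \<lparr> pverts = V,
     parcs = (\<lambda>v. (v, par v)) ` (V - {r}) \<union> (\<lambda>v. (par v, v)) ` (V - {r}) \<rparr>"

lemma tree_graph_simps [simp]:
  "pverts (tree_graph V r par) = V"
  "parcs (tree_graph V r par) =
     (\<lambda>v. (v, par v)) ` (V - {r}) \<union> (\<lambda>v. (par v, v)) ` (V - {r})"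
  by (simp_all add: tree_graph_def)

text \<open>The depth \<open>h\<close> makes \<open>par\<close> well-founded off the root, and
  \<open>par r = r\<close> makes iterating past the root harmless.\<close>

locale rooted_tree =
  fixes V :: "'a set" and r :: 'a and par :: "'a \<Rightarrow> 'a" and h :: "'a \<Rightarrow> nat"
  assumes finite_V: "finite V"
    and root_in: "r \<in> V"
    and par_root: "par r = r"
    and par_in: "v \<in> V \<Longrightarrow> par v \<in> V"
    and h_root: "h r = 0"
    and h_par: "v \<in> V \<Longrightarrow> v \<noteq> r \<Longrightarrow> h v = Suc (h (par v))"
begin

abbreviation G where "G \<equiv> tree_graph V r par"

text \<open>For \<open>v \<noteq> r\<close> in \<open>V\<close> this is the component containing
  \<open>v\<close> once the edge to \<open>par v\<close> is removed; \<open>i = 0\<close> puts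
  \<open>v\<close> itself into it.\<close>

definition desc :: "'a \<Rightarrow> 'a set" where
  "desc v = {w \<in> V. \<exists>i. (par ^^ i) w = v}"

definition children :: "'a \<Rightarrow> 'a set" where
  "children v = {w \<in> V - {r}. par w = v}"

lemma h_eq_0_iff: "v \<in> V \<Longrightarrow> h v = 0 \<longleftrightarrow> v = r"
  using h_par h_root by force

lemma h_par_eq: "v \<in> V \<Longrightarrow> h (par v) = h v - 1"
  using h_par h_root par_root by (cases "v = r") auto

lemma iter_in: "v \<in> V \<Longrightarrow> (par ^^ i) v \<in> V"
  by (induction i) (auto intro: par_in)

text \<open>Truncated subtraction matches the fixed root: once it is reached, the depth stays
  0.\<close>

lemma h_iter: "v \<in> V \<Longrightarrow> h ((par ^^ i) v) = h v - i"
  by (induction i) (auto simp: h_par_eq iter_in)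

lemma iter_root: "(par ^^ i) r = r"
  by (induction i) (auto simp: par_root)

lemma iter_eq_root_iff: "v \<in> V \<Longrightarrow> (par ^^ i) v = r \<longleftrightarrow> h v \<le> i"
  using h_eq_0_iff[OF iter_in, of v i] by (simp add: h_iter)

lemma par_neq: "v \<in> V \<Longrightarrow> v \<noteq> r \<Longrightarrow> par v \<noteq> v"
  using h_par by force

lemma finite_desc [simp]: "finite (desc v)"
  using finite_V by (simp add: desc_def)

lemma desc_subset: "desc v \<subseteq> V"
  by (auto simp: desc_def)

lemma desc_self: "v \<in> V \<Longrightarrow> v \<in> desc v"
  by (auto simp: desc_def intro: exI[of _ 0])

lemma desc_par_iff:
  assumes "w \<in> V" "w \<noteq> v"
  shows "par w \<in> desc v \<longleftrightarrow> w \<in> desc v"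
proof
  assume "par w \<in> desc v"
  then obtain i where "(par ^^ i) (par w) = v" by (auto simp: desc_def)
  then have "(par ^^ Suc i) w = v" by (simp add: funpow_swap1)
  then show "w \<in> desc v" using assms unfolding desc_def by blast
next
  assume "w \<in> desc v"
  then obtain i where i: "(par ^^ i) w = v" by (auto simp: desc_def)
  with assms obtain j where "i = Suc j" by (cases i) auto
  with i have "(par ^^ j) (par w) = v" by (simp add: funpow_swap1)
  then show "par w \<in> desc v" using assms unfolding desc_def by (auto intro: par_in)
qed

text \<open>Depths fix the number of steps from \<open>w\<close> up to \<open>v\<close>, so the
  existential over iterates becomes a single equation.\<close>

lemma desc_iff:
  assumes "v \<in> V"
  shows "w \<in> desc v \<longleftrightarrow> w \<in> V \<and> h v \<le> h w \<and> (par ^^ (h w - h v)) w = v"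
proof (intro iffI conjI)
  assume w: "w \<in> desc v"
  then obtain i where i: "(par ^^ i) w = v" and wV: "w \<in> V" by (auto simp: desc_def)
  have hv: "h v = h w - i" using h_iter[OF wV, of i] i by simp
  show "w \<in> V" "h v \<le> h w" using wV hv by auto
  show "(par ^^ (h w - h v)) w = v"
  proof (cases "i \<le> h w")
    case True
    then show ?thesis using hv i by simp
  next
    case False
    then have "v = r" using i iter_eq_root_iff[OF wV, of i] by simp
    then show ?thesis using iter_eq_root_iff[OF wV] h_root by simp
  qed
qed (auto simp: desc_def)

lemma desc_trans: "w \<in> desc v \<Longrightarrow> desc w \<subseteq> desc v"
proof
  fix x assume "w \<in> desc v" "x \<in> desc w"
  then obtain i j where "(par ^^ i) w = v" "(par ^^ j) x = w" "x \<in> V"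
    by (auto simp: desc_def)
  then have "(par ^^ (i + j)) x = v" "x \<in> V" by (simp_all add: funpow_add)
  then show "x \<in> desc v" unfolding desc_def by blast
qed

lemma desc_disjoint:
  assumes "v \<in> V" "w \<in> V" "h v = h w" "v \<noteq> w"
  shows "desc v \<inter> desc w = {}"
  using assms by (auto simp: desc_iff)

lemma desc_child_subset: "w \<in> children v \<Longrightarrow> v \<in> V \<Longrightarrow> desc w \<subseteq> desc v"
proof (rule desc_trans)
  assume "w \<in> children v" "v \<in> V"
  then show "w \<in> desc v" unfolding children_def desc_def by (auto intro!: exI[of _ 1])
qed

lemma root_not_desc:
  assumes "v \<in> V" "v \<noteq> r"
  shows "r \<notin> desc v"
  using assms by (auto simp: desc_def iter_root)

lemma card_desc_eq: "card (desc v) = (\<Sum>w\<in>V. if w \<in> desc v then 1 else 0)"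
  using finite_V desc_subset[of v] by (simp add: sum.If_cases Int_absorb1)

text \<open>Double counting of the pairs with \<open>w \<in> desc v\<close>: for given
  \<open>w\<close> the vertices \<open>v\<close> are its iterates with exponent below
  \<open>h w\<close>.\<close>

lemma sum_card_desc: "(\<Sum>v\<in>V - {r}. card (desc v)) = (\<Sum>v\<in>V. h v)"
proof -
  have anc: "card {v \<in> V - {r}. w \<in> desc v} = h w" if w: "w \<in> V" for w
  proof -
    have "{v \<in> V - {r}. w \<in> desc v} = (\<lambda>i. (par ^^ i) w) ` {..<h w}"
    proof (intro equalityI subsetI)
      fix v assume "v \<in> {v \<in> V - {r}. w \<in> desc v}"
      then obtain i where "v \<noteq> r" "(par ^^ i) w = v" by (auto simp: desc_def)
      then show "v \<in> (\<lambda>i. (par ^^ i) w) ` {..<h w}"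
        using iter_eq_root_iff[OF w, of i] by auto
    next
      fix v assume "v \<in> (\<lambda>i. (par ^^ i) w) ` {..<h w}"
      then obtain i where "i < h w" "v = (par ^^ i) w" by auto
      then show "v \<in> {v \<in> V - {r}. w \<in> desc v}"
        using iter_eq_root_iff[OF w, of i] iter_in[OF w] w by (auto simp: desc_def)
    qed
    moreover have "inj_on (\<lambda>i. (par ^^ i) w) {..<h w}"
    proof (rule inj_onI)
      fix i j assume "i \<in> {..<h w}" "j \<in> {..<h w}" "(par ^^ i) w = (par ^^ j) w"
      then show "i = j" using h_iter[OF w, of i] h_iter[OF w, of j] by auto
    qed
    ultimately show ?thesis by (simp add: card_image)
  qed
  have "(\<Sum>v\<in>V - {r}. card (desc v)) = (\<Sum>w\<in>V. \<Sum>v\<in>V - {r}. if w \<in> desc v then 1 else 0)"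
    unfolding card_desc_eq by (rule sum.swap)
  also have "\<dots> = (\<Sum>w\<in>V. card {v \<in> V - {r}. w \<in> desc v})"
    using finite_V by (intro sum.cong refl) (simp add: sum.If_cases Int_def)
  also have "\<dots> = (\<Sum>w\<in>V. h w)" by (intro sum.cong refl anc)
  finally show ?thesis .
qed

lemma pair_graph_G: "pair_graph G"
proof
  show "symmetric G" by (auto simp: symmetric_def sym_def)
  show "finite (pverts G)" "finite (parcs G)" using finite_V by auto
  fix e assume "e \<in> parcs G"
  then show "fst e \<in> pverts G" "snd e \<in> pverts G" using par_in by auto
  show "fst e \<noteq> snd e" using \<open>e \<in> parcs G\<close> par_neq by force
qed

sublocale pg: pair_graph G by (rule pair_graph_G)

lemma reaches_root: "v \<in> V \<Longrightarrow> v \<rightarrow>\<^sup>*\<^bsub>G\<^esub> r"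
proof (induction "h v" arbitrary: v)
  case 0
  then have "v = r" using h_eq_0_iff[of v] by simp
  then show ?case using root_in by simp
next
  case (Suc d)
  then have "v \<noteq> r" using h_root by auto
  then have "(v, par v) \<in> parcs G" using Suc.prems by auto
  moreover have "par v \<rightarrow>\<^sup>*\<^bsub>G\<^esub> r" 
    using Suc.hyps(1)[of "par v"] Suc.hyps(2) Suc.prems h_par_eq[of v] par_in[of v] by simp
  ultimately show ?case by (metis pg.adj_reachable_trans)
qed

lemma reachable: "u \<in> V \<Longrightarrow> v \<in> V \<Longrightarrow> u \<rightarrow>\<^sup>*\<^bsub>G\<^esub> v"
  by (meson pg.reachable_trans pg.symmetric_reachable' reaches_root)

lemma connected_G: "Digraph_Component.connected (with_proj G)"
proof -
  have "symcl (arcs_ends (with_proj G)) = arcs_ends (with_proj G)"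
    by (auto simp: symcl_def)
  then show ?thesis
    using root_in reachable unfolding connected_conv reachable_def by auto
qed

text \<open>With \<open>desc_par_mono\<close> this says that the edge between \<open>v\<close> and
  \<open>par v\<close> is the only one joining \<open>desc v\<close> to the rest, which is the cut
  condition used below.\<close>

lemma desc_leave: "w \<in> desc v \<Longrightarrow> par w \<notin> desc v \<Longrightarrow> w = v"
  using desc_par_iff[of w v] by (auto simp: desc_def)

lemma desc_par_mono: "w \<in> V \<Longrightarrow> par w \<in> desc v \<Longrightarrow> w \<in> desc v"
  using desc_par_iff[of w v] desc_self[of v] by auto

lemma par_notin_desc: "v \<in> V \<Longrightarrow> v \<noteq> r \<Longrightarrow> par v \<notin> desc v"
  using h_par desc_iff[of v "par v"] by auto

end

section \<open>Walks and distances across a bridge\<close>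

lemma (in pair_wf_digraph) awalk_cut_decomp:
  assumes "awalk u p w" "u \<in> S" "w \<notin> S"
    and "\<And>e. e \<in> parcs G \<Longrightarrow> fst e \<in> S \<Longrightarrow> snd e \<notin> S \<Longrightarrow> e = (a, b)"
  obtains p1 p2 where "p = p1 @ (a, b) # p2" "awalk u p1 a" "awalk b p2 w"
proof -
  \<comment> \<open>Induction along the walk up to its first arc out of \<open>S\<close>, which has
    to be \<open>(a, b)\<close>.\<close>
  have "\<exists>p1 p2. p = p1 @ (a, b) # p2 \<and> awalk u p1 a \<and> awalk b p2 w"
    using assms(1,2)
  proof (induction p arbitrary: u)
    case Nil
    then show ?case using assms(3) by (auto simp: awalk_Nil_iff)
  next
    case (Cons e es)
    then have e: "e \<in> parcs G" "fst e = u" "awalk (snd e) es w" and "u \<in> pverts G"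
      by (auto simp: awalk_Cons_iff arc_fst_in_verts)
    show ?case
    proof (cases "snd e \<in> S")
      case True
      then obtain p1 p2 where "es = p1 @ (a, b) # p2" "awalk (snd e) p1 a" "awalk b p2 w"
        using Cons.IH e by blast
      then show ?thesis
        using e by (intro exI[of _ "e # p1"] exI[of _ p2]) (simp add: awalk_Cons_iff)
    next
      case False
      then have "e = (a, b)" using assms(4) e Cons.prems by auto
      then show ?thesis
        using e \<open>u \<in> pverts G\<close> by (intro exI[of _ "[]"] exI[of _ es]) (simp add: awalk_Nil_iff)
    qed
  qed
  then show ?thesis using that by blast
qed

text \<open>The path has to cross \<open>(a, b)\<close>; anything before this arc would repeat
  \<open>a\<close>, anything after it would repeat \<open>b\<close>.\<close>

lemma (in pair_wf_digraph) apath_bridge: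
  assumes "apath a p b" "a \<in> S" "b \<notin> S"
    and "\<And>e. e \<in> parcs G \<Longrightarrow> fst e \<in> S \<Longrightarrow> snd e \<notin> S \<Longrightarrow> e = (a, b)"
  shows "p = [(a, b)]"
proof -
  have "awalk a p b" using assms(1) by (rule awalkI_apath)
  then obtain p1 p2 where p: "p = p1 @ (a, b) # p2" "awalk a p1 a" "awalk b p2 b"
    by (rule awalk_cut_decomp[of a p b S]) (use assms in auto)
  have d: "distinct (pawalk_verts a p)" using assms(1) by (simp add: apath_def)
  have "p1 = []"
  proof (rule ccontr)
    assume "p1 \<noteq> []"
    then obtain e es where "p1 = e # es" by (cases p1) auto
    then have "fst e = a" using p(2) by (simp add: awalk_Cons_iff)
    then have "pawalk_verts a p = a # pawalk_verts (snd e) (es @ (a, b) # p2)"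
      using p(1) \<open>p1 = e # es\<close> by simp
    then show False
      using d awalk_verts_arc1[of "(a, b)" "es @ (a, b) # p2" "snd e"] by simp
  qed
  moreover have "p2 = []"
  proof (rule ccontr)
    assume "p2 \<noteq> []"
    have "apath b p2 b" using assms(1) p(1) \<open>p1 = []\<close> by (simp add: apath_Cons_iff)
    with \<open>p2 \<noteq> []\<close> show False using apath_nonempty_ends by blast
  qed
  ultimately show ?thesis using p(1) by simp
qed

lemma (in pair_graph) awalk_cost_unit: "awalk_cost (\<lambda>_. 1) p = real (length p)"
  by (induction p) auto

lemma (in pair_graph) graph_dist_awalk:
  assumes "u \<rightarrow>\<^sup>*\<^bsub>G\<^esub> v"
  obtains p where "awalk u p v" "graph_dist G u v = length p"
proof -
  obtain p where "apath u p v" "graph_dist G u v = awalk_cost (\<lambda>_. 1) p"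
    unfolding graph_dist_def using min_cost_awalk[OF assms, of "\<lambda>_. 1"] by auto
  then show ?thesis using that[of p] by (simp add: awalk_cost_unit awalkI_apath)
qed

lemma (in pair_graph) graph_dist_le_length:
  assumes "awalk u p v"
  shows "graph_dist G u v \<le> length p"
  unfolding graph_dist_def
  using min_cost_le_walk_cost[OF assms, of "\<lambda>_. 1"] by (simp add: awalk_cost_unit)

text \<open>A shortest walk to \<open>b\<close> uses \<open>(a, b)\<close>; cut off there, it
  reaches \<open>a\<close> with at least one arc less.\<close>

lemma (in pair_graph) graph_dist_cut:
  assumes "u \<rightarrow>\<^sup>*\<^bsub>G\<^esub> b" "u \<in> S" "b \<notin> S"
    and "\<And>e. e \<in> parcs G \<Longrightarrow> fst e \<in> S \<Longrightarrow> snd e \<notin> S \<Longrightarrow> e = (a, b)"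
  shows "graph_dist G u a < graph_dist G u b"
proof -
  obtain p where p: "awalk u p b" "graph_dist G u b = length p"
    using graph_dist_awalk[OF assms(1)] by blast
  obtain p1 p2 where "p = p1 @ (a, b) # p2" "awalk u p1 a"
    using awalk_cut_decomp[of u p b S a b] p(1) assms(2-4) by metis
  moreover from this have "graph_dist G u a \<le> length p1" by (intro graph_dist_le_length)
  ultimately show ?thesis using p(2) by (simp add: order_le_less_trans)
qed

section \<open>Absence of cycles in a rooted tree\<close>

context rooted_tree
begin

text \<open>A cycle minus its first arc is a path between the ends of a bridge, so by
  \<open>apath_bridge\<close> it is the reversed arc and the cycle has only two arcs.\<close>

lemma acyclic_G: "\<not> (\<exists>p. pg.cycle p \<and> length p \<ge> 3)"
proof
  assume "\<exists>p. pg.cycle p \<and> length p \<ge> 3"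
  then obtain u p where p: "pg.awalk u p u" "distinct (tl (pawalk_verts u p))" "length p \<ge> 3"
    by (auto simp: pg.cycle_def)
  then obtain e q where pq: "p = e # q" by (cases p) auto
  then have e: "e \<in> parcs G" "u = fst e" and q: "pg.apath (snd e) q (fst e)"
    using p by (auto simp: pg.awalk_Cons_iff pg.apath_def)
  have "q = [(snd e, fst e)]"
  proof -
    from e(1) consider v where "v \<in> V" "v \<noteq> r" "e = (v, par v)"
      | v where "v \<in> V" "v \<noteq> r" "e = (par v, v)" by auto
    then show ?thesis
    proof cases
      case 1
      show ?thesis
        by (rule pg.apath_bridge[OF q, of "- desc v"])
          (use 1 in \<open>auto simp: desc_self par_notin_desc dest: desc_leave desc_par_mono\<close>)
    next
      case 2
      show ?thesis
        by (rule pg.apath_bridge[OF q, of "desc v"])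
          (use 2 in \<open>auto simp: desc_self par_notin_desc dest: desc_leave desc_par_mono\<close>)
    qed
  qed
  then show False using p(3) pq by simp
qed

lemma simple_tree_G: "simple_tree G"
  unfolding simple_tree_def using pair_graph_G connected_G acyclic_G by simp

section \<open>The Mostar index of a rooted tree\<close>

text \<open>\<open>graph_dist_cut\<close> in both directions across the bridge: from
  \<open>desc v\<close> the nearer end is \<open>v\<close>, from the complement it is
  \<open>par v\<close>.\<close>

lemma n_closer_parent:
  assumes "v \<in> V" "v \<noteq> r"
  shows "n_closer G v (par v) = card (desc v)"
    and "n_closer G (par v) v = card V - card (desc v)"
proof -
  have up: "graph_dist G w v < graph_dist G w (par v)" if "w \<in> desc v" for w
    by (rule pg.graph_dist_cut[of _ _ "desc v"])
      (use that assms desc_subset in \<open>auto simp: par_notin_desc intro!: reachable par_in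
         dest: desc_leave desc_par_mono\<close>)
  have down: "graph_dist G w (par v) < graph_dist G w v" if "w \<in> V" "w \<notin> desc v" for w
    by (rule pg.graph_dist_cut[of _ _ "- desc v"])
      (use that assms in \<open>auto simp: desc_self intro!: reachable
         dest: desc_leave desc_par_mono\<close>)
  have "{w \<in> V. graph_dist G w v < graph_dist G w (par v)} = desc v"
    using up down desc_subset[of v] by (auto dest: order.asym)
  then show "n_closer G v (par v) = card (desc v)" by (simp add: n_closer_def)
  have "{w \<in> V. graph_dist G w (par v) < graph_dist G w v} = V - desc v"
    using up down desc_subset[of v] by (auto dest: order.asym)
  then show "n_closer G (par v) v = card V - card (desc v)"
    by (simp add: n_closer_def card_Diff_subset desc_subset)
qed

lemma graph_edges_G: "graph_edges G = (\<lambda>v. {v, par v}) ` (V - {r})"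
  unfolding graph_edges_def by (auto simp: insert_commute)

text \<open>The child is the deeper end of an edge, so the edge determines it.\<close>

lemma inj_on_edges: "inj_on (\<lambda>v. {v, par v}) (V - {r})"
proof (rule inj_onI)
  fix v w assume vw: "v \<in> V - {r}" "w \<in> V - {r}" "{v, par v} = {w, par w}"
  then show "v = w"
    using h_par[of v] h_par[of w] by (auto simp: doubleton_eq_iff)
qed

lemma mostar_index_G:
  "mostar_index G = (\<Sum>v\<in>V - {r}. \<bar>int (card V) - 2 * int (card (desc v))\<bar>)"
proof -
  have "edge_imbalance G {v, par v} = \<bar>int (card V) - 2 * int (card (desc v))\<bar>"
    if "v \<in> V - {r}" for v
  proof -
    have "card (desc v) \<le> card V" using finite_V by (intro card_mono desc_subset)
    then show ?thesis
      using that by (simp add: edge_imbalance_doubleton n_closer_parent of_nat_diff)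
  qed
  then show ?thesis
    unfolding mostar_index_def graph_edges_G
    by (subst sum.reindex[OF inj_on_edges]) (simp add: o_def)
qed

text \<open>Without absolute values only the depths matter, by \<open>sum_card_desc\<close>; there
  are \<open>card V - 1\<close> terms.\<close>

lemma sum_imbalance:
  "(\<Sum>v\<in>V - {r}. int (card V) - 2 * int (card (desc v))) =
     int (card V) * (int (card V) - 1) - 2 * int (\<Sum>v\<in>V. h v)"
proof -
  have "card (V - {r}) = card V - 1" "card V \<ge> 1"
    using root_in finite_V by (auto simp: Suc_le_eq card_gt_0_iff)
  then show ?thesis
    by (simp add: sum_subtractf of_nat_diff algebra_simps flip: sum_distrib_left sum_card_desc)
qed

lemma mostar_index_ge:
  "mostar_index G \<ge> int (card V) * (int (card V) - 1) - 2 * int (\<Sum>v\<in>V. h v)"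
  unfolding mostar_index_G sum_imbalance[symmetric] by (intro sum_mono) simp

text \<open>The hypothesis makes the root a centroid; then no term is negative and the absolute
  values drop out.\<close>

lemma mostar_index_eq:
  assumes "\<And>v. v \<in> V \<Longrightarrow> v \<noteq> r \<Longrightarrow> 2 * card (desc v) \<le> card V"
  shows "mostar_index G = int (card V) * (int (card V) - 1) - 2 * int (\<Sum>v\<in>V. h v)"
  unfolding mostar_index_G sum_imbalance[symmetric]
  using assms by (intro sum.cong refl) (force simp: abs_if)

end

section \<open>Rooting an arbitrary tree\<close>

lemma simple_tree_rooted:
  fixes G :: "'a pair_pre_digraph"
  assumes "simple_tree G"
  obtains r par h where "rooted_tree (pverts G) r par h" "G = tree_graph (pverts G) r par"
proof -
  interpret pair_graph G using assms by (simp add: simple_tree_def)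
  have "Digraph_Component.connected (with_proj G)" using assms by (simp add: simple_tree_def)
  then have "strongly_connected (with_proj G)"
    using symmetric_connected_imp_strongly_connected[OF sym_arcs] by simp
  \<comment> \<open>Any vertex can be the root; the parent will be the second vertex of a shortest
    walk to it, which is one step closer.\<close>
  then obtain r where r: "r \<in> pverts G" "\<And>v. v \<in> pverts G \<Longrightarrow> v \<rightarrow>\<^sup>*\<^bsub>G\<^esub> r"
    by (auto simp: strongly_connected_def)
  define d where "d v = (LEAST n. \<exists>p. awalk v p r \<and> length p = n)" for v
  have d_ex: "\<exists>p. awalk v p r \<and> length p = d v" if v: "v \<in> pverts G" for v
  proof -
    have "\<exists>n p. awalk v p r \<and> length p = n" using r(2)[OF v] by (auto simp: reachable_awalk)
    then show ?thesis unfolding d_def by (rule LeastI_ex)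
  qed
  have d_le: "d v \<le> length p" if "awalk v p r" for v p
    unfolding d_def using that by (intro Least_le) blast
  have step: "\<exists>x. (v, x) \<in> parcs G \<and> d v = Suc (d x)" if v: "v \<in> pverts G" "v \<noteq> r" for v
  proof -
    obtain p where p: "awalk v p r" "length p = d v" using d_ex[OF v(1)] by blast
    with v obtain x es where es: "p = (v, x) # es" "(v, x) \<in> parcs G" "awalk x es r"
      by (cases p) (auto simp: awalk_Nil_iff awalk_Cons_iff)
    obtain q where q: "awalk x q r" "length q = d x" using d_ex es(2) in_arcsD2 by blast
    have "d v \<le> Suc (d x)"
      using d_le[of v "(v, x) # q"] q es(2) by (simp add: awalk_Cons_iff)
    moreover have "d x \<le> length es" using es(3) by (rule d_le)
    ultimately show ?thesis using p es by auto
  qed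
  define par where
    "par v = (if v \<in> pverts G \<and> v \<noteq> r then SOME x. (v, x) \<in> parcs G \<and> d v = Suc (d x) else r)" for v
  have par: "(v, par v) \<in> parcs G" "d v = Suc (d (par v))" if "v \<in> pverts G" "v \<noteq> r" for v
    using someI_ex[OF step[OF that]] that by (auto simp: par_def)
  interpret T: rooted_tree "pverts G" r par d
  proof
    show "finite (pverts G)" "r \<in> pverts G" by (simp_all add: r)
    show "par r = r" by (simp add: par_def)
    show "d r = 0" using d_le[of r "[]"] r by (simp add: awalk_Nil_iff)
    fix v assume v: "v \<in> pverts G"
    show "par v \<in> pverts G"
    proof (cases "v = r")
      case True
      then show ?thesis using r by (simp add: par_def)
    next
      case False
      then show ?thesis using par(1)[OF v] in_arcsD2 by blast
    qed
    assume "v \<noteq> r"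
    then show "d v = Suc (d (par v))" using par v by blast
  qed
  have sub: "parcs T.G \<subseteq> parcs G" using par(1) arcs_symmetric by auto
  have "parcs G \<subseteq> parcs T.G"
  proof (rule subrelI, rule ccontr)
    fix x y assume xy: "(x, y) \<in> parcs G" and notin: "(x, y) \<notin> parcs T.G"
    have "x \<in> pverts G" "y \<in> pverts G" "x \<noteq> y" using xy in_arcsD1 in_arcsD2 no_loops' by blast+
    then obtain p where p: "T.pg.apath x p y"
      using T.reachable T.pg.reachable_apath by blast
    then have "set p \<subseteq> parcs T.G" "pcas x p y" "distinct (pawalk_verts x p)"
      unfolding T.pg.apath_def T.pg.awalk_def by auto
    then have p': "awalk x p y" "distinct (pawalk_verts x p)"
      using sub \<open>x \<in> pverts G\<close> by (auto simp: awalk_def)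
    \<comment> \<open>A tree path of length 0 would make \<open>(x, y)\<close> a loop, one of length
      1 would be the arc itself, so the path has at least two arcs.\<close>
    have "length p \<noteq> 0" using p' \<open>x \<noteq> y\<close> by (auto simp: awalk_Nil_iff)
    moreover have "length p \<noteq> 1"
    proof
      assume "length p = 1"
      then obtain e where "p = [e]" by (auto simp: length_Suc_conv)
      then have "p = [(x, y)]" using p'(1) by (cases e) (auto simp: awalk_Cons_iff awalk_Nil_iff)
      then show False using \<open>set p \<subseteq> parcs T.G\<close> notin by simp
    qed
    \<comment> \<open>an arc outside the tree of shortest paths closes a cycle with the tree path\<close>
    moreover have "cycle ((y, x) # p)"
      unfolding cycle_def using p' xy arcs_symmetric
      by (intro exI[of _ y]) (auto simp: awalk_Cons_iff)
    moreover have "length p \<ge> 2 \<Longrightarrow> length ((y, x) # p) \<ge> 3" by simp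
    ultimately show False using assms unfolding simple_tree_def
      by (metis One_nat_def Suc_1 less_2_cases not_less_eq_eq not_le)
  qed
  with sub have "parcs G = parcs T.G" by blast
  then have "G = T.G" by (intro pair_pre_digraph.equality) simp_all
  then show ?thesis using that T.rooted_tree_axioms by blast
qed

section \<open>Re-rooting and the centroid\<close>

context rooted_tree
begin

text \<open>Only the edge between \<open>r\<close> and its child \<open>c\<close> is turned round,
  so \<open>desc c\<close> rises by one level and all other vertices sink by one. The sums are
  compared additively because subtraction on naturals truncates.\<close>

lemma reroot:
  assumes c: "c \<in> V" "c \<noteq> r" "par c = r"
  defines "par' \<equiv> par(r := c, c := c)"
  defines "h' \<equiv> \<lambda>w. if w \<in> desc c then h w - 1 else Suc (h w)"
  shows "rooted_tree V c par' h'" "tree_graph V c par' = G"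
    and "(\<Sum>w\<in>V. h' w) + 2 * card (desc c) = (\<Sum>w\<in>V. h w) + card V"
proof -
  have hc: "h c = 1" using c h_par h_root by simp
  have pos: "h w \<ge> 1" if "w \<in> desc c" for w using that desc_iff[of c w] c hc by auto
  show "rooted_tree V c par' h'"
  proof
    show "finite V" "c \<in> V" by (simp_all add: finite_V c)
    show "par' c = c" "h' c = 0" using hc by (simp_all add: par'_def h'_def desc_self c)
    fix v assume v: "v \<in> V"
    show "par' v \<in> V" using v c par_in by (simp add: par'_def)
    assume vc: "v \<noteq> c"
    show "h' v = Suc (h' (par' v))"
    proof (cases "v = r")
      case True
      then show ?thesis
        using vc c hc root_not_desc[of c] by (simp add: par'_def h'_def desc_self h_root)
    next
      case False
      then show ?thesis
        using vc v h_par[of v] desc_par_iff[of v c] pos[of "par v"]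
        by (auto simp: par'_def h'_def)
    qed
  qed
  have "V - {c} = insert r (V - {r, c})" "V - {r} = insert c (V - {r, c})" using c root_in by auto
  moreover have "(\<lambda>v. (v, par' v)) ` (V - {r, c}) = (\<lambda>v. (v, par v)) ` (V - {r, c})"
    "(\<lambda>v. (par' v, v)) ` (V - {r, c}) = (\<lambda>v. (par v, v)) ` (V - {r, c})"
    by (auto simp: par'_def)
  ultimately show "tree_graph V c par' = G"
    using c by (simp add: tree_graph_def par'_def) blast
  have "h' w + 2 * (if w \<in> desc c then 1 else 0) = h w + 1" for w
    using pos[of w] by (auto simp: h'_def)
  then have "(\<Sum>w\<in>V. h' w + 2 * (if w \<in> desc c then 1 else 0)) = (\<Sum>w\<in>V. h w + 1)" by presburger
  then show "(\<Sum>w\<in>V. h' w) + 2 * card (desc c) = (\<Sum>w\<in>V. h w) + card V"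
    by (simp add: sum.distrib sum_Suc card_desc_eq flip: sum_distrib_left)
qed

lemma top_ancestor:
  assumes "v \<in> V" "v \<noteq> r"
  obtains c where "c \<in> V" "c \<noteq> r" "par c = r" "v \<in> desc c"
proof -
  define c where "c = (par ^^ (h v - 1)) v"
  have pos: "h v \<ge> 1" using assms h_eq_0_iff[of v] by (cases "h v") auto
  have "h c = 1" using h_iter[OF assms(1), of "h v - 1"] pos by (simp add: c_def)
  moreover have "c \<in> V" using assms by (simp add: c_def iter_in)
  moreover from calculation have "par c = r"
    using h_par_eq[of c] par_in[of c] h_eq_0_iff[of "par c"] by simp
  moreover have "v \<in> desc c" using assms unfolding c_def desc_def by blast
  moreover have "c \<noteq> r" using \<open>h c = 1\<close> h_root by auto
  ultimately show ?thesis using that by blast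
qed

text \<open>
  By \<open>reroot\<close>, moving the root to a child \<open>c\<close> changes the sum of the depths by
  \<open>n - 2 \<bar>desc c\<bar>\<close>; so a root minimising that sum is a centroid.
\<close>

lemma centroid:
  obtains r' par' h' where "rooted_tree V r' par' h'" "tree_graph V r' par' = G"
    "mostar_index G = int (card V) * (int (card V) - 1) - 2 * int (\<Sum>v\<in>V. h' v)"
proof -
  \<comment> \<open>Rootings of the given graph are packed as triples, so that one with the least
    sum of depths can be chosen.\<close>
  define P where "P = (\<lambda>(r', par', h'). rooted_tree V r' par' h' \<and> tree_graph V r' par' = G)"
  define m where "m = (\<lambda>(r' :: 'a, par' :: 'a \<Rightarrow> 'a, h' :: 'a \<Rightarrow> nat). \<Sum>v\<in>V. h' v)"
  have "P (r, par, h)" using rooted_tree_axioms by (simp add: P_def)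
  then obtain x where x: "P x" "\<And>y. P y \<Longrightarrow> m x \<le> m y"
    using ex_has_least_nat[of P "(r, par, h)" m] by blast
  obtain r' par' h' where x_eq: "x = (r', par', h')" by (cases x)
  have C: "rooted_tree V r' par' h'" and G_eq: "tree_graph V r' par' = G"
    using x(1) x_eq by (auto simp: P_def)
  interpret C: rooted_tree V r' par' h' by (rule C)
  have child: "2 * card (C.desc c) \<le> card V" if c: "c \<in> V" "c \<noteq> r'" "par' c = r'" for c
  proof -
    define y where "y = (c, par'(r' := c, c := c), \<lambda>w. if w \<in> C.desc c then h' w - 1 else Suc (h' w))"
    have "P y" using C.reroot(1,2)[OF c] G_eq by (simp add: P_def y_def)
    then have "m x \<le> m y" by (rule x(2))
    then show ?thesis using C.reroot(3)[OF c] by (simp add: m_def y_def x_eq)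
  qed
  \<comment> \<open>Subtrees shrink downwards, so it is enough to bound those at the children of the
    root.\<close>
  have "2 * card (C.desc v) \<le> card V" if v: "v \<in> V" "v \<noteq> r'" for v
  proof -
    obtain c where c: "c \<in> V" "c \<noteq> r'" "par' c = r'" "v \<in> C.desc c"
      using C.top_ancestor[OF v] by blast
    have "card (C.desc v) \<le> card (C.desc c)" using C.desc_trans[OF c(4)] by (simp add: card_mono)
    then show ?thesis using child[OF c(1-3)] by simp
  qed
  then have "mostar_index G = int (card V) * (int (card V) - 1) - 2 * int (\<Sum>v\<in>V. h' v)"
    using C.mostar_index_eq G_eq by simp
  then show ?thesis using that C G_eq by blast
qed

section \<open>Leaves and levels\<close>

definition leaves :: "'a set" where
  "leaves = {v \<in> V - {r}. children v = {}}"

lemma finite_children [simp]: "finite (children v)"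
  using finite_V by (simp add: children_def)

lemma finite_leaves [simp]: "finite leaves"
  using finite_V by (simp add: leaves_def)

lemma out_degree_G:
  assumes "v \<in> V"
  shows "out_degree (with_proj G) v = card (children v) + (if v = r then 0 else 1)"
proof -
  have "out_arcs (with_proj G) v =
      (\<lambda>w. (v, w)) ` (children v \<union> (if v = r then {} else {par v}))"
    using assms by (auto simp: out_arcs_def children_def)
  moreover have "par v \<notin> children v" if "v \<noteq> r"
    using that assms h_par[of v] h_par[of "par v"] by (auto simp: children_def)
  ultimately show ?thesis
    unfolding out_degree_def by (simp add: card_image inj_on_def)
qed

text \<open>A leaf is adjacent to its parent only, and 1 is odd.\<close>

lemma card_leaves_le: "card leaves \<le> card (odd_vertices G)"
proof (rule card_mono)
  show "finite (odd_vertices G)" using finite_V by (simp add: odd_vertices_def)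
  show "leaves \<subseteq> odd_vertices G"
    by (auto simp: odd_vertices_def leaves_def out_degree_G)
qed

text \<open>A deepest descendant of \<open>v\<close> cannot have a child.\<close>

lemma ex_leaf_desc:
  assumes "v \<in> V" "v \<noteq> r"
  obtains l where "l \<in> leaves" "l \<in> desc v"
proof -
  have "Max (h ` desc v) \<in> h ` desc v" using desc_self[OF assms(1)] by (intro Max_in) auto
  then obtain l where l: "l \<in> desc v" "h l = Max (h ` desc v)" by auto
  then have max: "h x \<le> h l" if "x \<in> desc v" for x using that by simp
  have "l \<in> V" using l(1) desc_subset by blast
  have "children l = {}"
  proof (rule ccontr)
    assume "children l \<noteq> {}"
    then obtain w where w: "w \<in> children l" by blast
    then have "w \<in> desc v"
      using desc_child_subset[OF w \<open>l \<in> V\<close>] desc_trans[OF l(1)] desc_self[of w]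
      by (auto simp: children_def)
    then show False using max[of w] w h_par[of w] by (auto simp: children_def)
  qed
  then show ?thesis
    using that[of l] l(1) \<open>l \<in> V\<close> assms root_not_desc[of v] by (auto simp: leaves_def)
qed

text \<open>Each subtree contains a leaf, and disjoint subtrees contain different ones.\<close>

lemma antichain_le_leaves:
  assumes "X \<subseteq> V - {r}" "\<And>x y. x \<in> X \<Longrightarrow> y \<in> X \<Longrightarrow> x \<noteq> y \<Longrightarrow> desc x \<inter> desc y = {}"
  shows "card X \<le> card leaves"
proof -
  have "\<forall>x\<in>X. \<exists>l. l \<in> leaves \<and> l \<in> desc x" using assms(1) ex_leaf_desc by blast
  then obtain f where f: "\<And>x. x \<in> X \<Longrightarrow> f x \<in> leaves \<and> f x \<in> desc x" by metis
  have "inj_on f X"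
  proof (rule inj_onI, rule ccontr)
    fix x y assume "x \<in> X" "y \<in> X" "f x = f y" "x \<noteq> y"
    then show False using assms(2)[of x y] f[of x] f[of y] by auto
  qed
  then show ?thesis
    by (rule card_inj_on_le) (use f in auto)
qed

section \<open>Level sizes and the sum of depths\<close>

lemma card_level_le: "d > 0 \<Longrightarrow> card {v \<in> V. h v = d} \<le> card leaves"
  by (rule antichain_le_leaves) (use h_root desc_disjoint in auto)

lemma card_ball_le: "card {v \<in> V. h v \<le> d} \<le> 1 + card leaves * d"
proof (induction d)
  case 0
  have "{v \<in> V. h v \<le> 0} = {r}" using h_eq_0_iff root_in h_root by auto
  then show ?case by simp
next
  case (Suc d)
  have "{v \<in> V. h v \<le> Suc d} = {v \<in> V. h v \<le> d} \<union> {v \<in> V. h v = Suc d}" by auto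
  then have "card {v \<in> V. h v \<le> Suc d} \<le> card {v \<in> V. h v \<le> d} + card {v \<in> V. h v = Suc d}"
    by (simp add: card_Un_le)
  then show ?case using Suc card_level_le[of "Suc d"] by simp
qed

text \<open>Complement of \<open>card_ball_le\<close>; truncated subtraction turns the bound into 0
  once \<open>m * d\<close> is too large.\<close>

lemma card_above_ge:
  assumes "card leaves \<le> m"
  shows "card {v \<in> V. h v > d} \<ge> card V - 1 - m * d"
proof -
  have "card V = card ({v \<in> V. h v \<le> d} \<union> {v \<in> V. h v > d})"
    by (rule arg_cong[of _ _ card]) auto
  also have "\<dots> \<le> card {v \<in> V. h v \<le> d} + card {v \<in> V. h v > d}"
    by (rule card_Un_le)
  finally have "card V \<le> card {v \<in> V. h v \<le> d} + card {v \<in> V. h v > d}" .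
  moreover have "card leaves * d \<le> m * d" using assms by simp
  ultimately show ?thesis using card_ball_le[of d] by linarith
qed

text \<open>Each vertex is counted once for every \<open>d < h v\<close>; \<open>N\<close> may be
  any bound on the depths.\<close>

lemma sum_h_eq:
  assumes "\<And>v. v \<in> V \<Longrightarrow> h v \<le> N"
  shows "(\<Sum>v\<in>V. h v) = (\<Sum>d<N. card {v \<in> V. h v > d})"
proof -
  have "h v = (\<Sum>d<N. if d < h v then 1 else 0)" if "v \<in> V" for v
  proof -
    have "{..<N} \<inter> {d. d < h v} = {..<h v}" using assms[OF that] by auto
    then show ?thesis by (simp add: sum.If_cases)
  qed
  then have "(\<Sum>v\<in>V. h v) = (\<Sum>v\<in>V. \<Sum>d<N. if d < h v then 1 else 0)"
    by (intro sum.cong refl)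
  also have "\<dots> = (\<Sum>d<N. \<Sum>v\<in>V. if d < h v then 1 else 0)" by (rule sum.swap)
  also have "\<dots> = (\<Sum>d<N. card {v \<in> V. h v > d})"
    using finite_V by (intro sum.cong refl) (simp add: sum.If_cases Int_def)
  finally show ?thesis .
qed

text \<open>Evaluates the depth sum of the competitor. \<open>N\<close> stays free so that the value
  can be compared with a tree whose depth is not known in advance.\<close>

lemma sum_h_balanced:
  assumes "m \<ge> 1" "\<And>d. card {v \<in> V. h v > d} = card V - 1 - m * d"
    and "N \<ge> card V"
  shows "(\<Sum>v\<in>V. h v) = (\<Sum>d<N. card V - 1 - m * d)"
proof -
  have "h v \<le> N" if "v \<in> V" for v
  proof (rule ccontr)
    assume "\<not> h v \<le> N"
    then have "v \<in> {v \<in> V. h v > N}" using that by simp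
    then have "card {v \<in> V. h v > N} > 0" using finite_V by (auto simp: card_gt_0_iff)
    moreover have "N \<le> m * N" using assms(1) by simp
    ultimately show False using assms(2)[of N] assms(3) by linarith
  qed
  from sum_h_eq[OF this] show ?thesis using assms(2) by simp
qed

text \<open>\<open>card_above_ge\<close> bounds the depth sum from below term by term, so a sum that
  is no larger forces equality in every term.\<close>

lemma balanced_if_sum_le:
  assumes "m \<ge> 1" "card leaves \<le> m"
    and "\<And>N. N \<ge> card V \<Longrightarrow> (\<Sum>v\<in>V. h v) \<le> (\<Sum>d<N. card V - 1 - m * d)"
  shows "card {v \<in> V. h v > d} = card V - 1 - m * d"
proof -
  \<comment> \<open>Large enough to bound all depths, to meet the third hypothesis and to have
    \<open>d\<close> among the summation indices.\<close>
  define N where "N = Max (h ` V) + card V + d + 1"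
  have "h v \<le> N" if "v \<in> V" for v
  proof -
    have "h v \<le> Max (h ` V)" using finite_V that by (intro Max_ge) auto
    then show ?thesis by (simp add: N_def)
  qed
  then have "(\<Sum>d<N. card {v \<in> V. h v > d}) \<le> (\<Sum>d<N. card V - 1 - m * d)"
    using assms(3)[of N] sum_h_eq[of N] by (simp add: N_def)
  moreover have "(\<Sum>d<N. card V - 1 - m * d) \<le> (\<Sum>d<N. card {v \<in> V. h v > d})"
    by (intro sum_mono card_above_ge assms)
  ultimately have "(\<Sum>d<N. card V - 1 - m * d) = (\<Sum>d<N. card {v \<in> V. h v > d})" by simp
  then have "card V - 1 - m * d = card {v \<in> V. h v > d}"
    by (rule sum_mono_inv) (use card_above_ge[OF assms(2)] in \<open>auto simp: N_def\<close>)
  then show ?thesis by simp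
qed

text \<open>If \<open>par w\<close> had two children, replacing its ancestor at depth 1 by these two
  would turn the first level into an antichain with more elements than there are leaves.\<close>

lemma unique_child:
  assumes "card leaves \<le> card {v \<in> V. h v = 1}"
    and w: "w \<in> V" "w' \<in> V" "par w = par w'" "par w \<noteq> r"
  shows "w = w'"
proof (rule ccontr)
  assume "w \<noteq> w'"
  define v where "v = par w"
  have v: "v \<in> V" "v \<noteq> r" using w par_in by (auto simp: v_def)
  then obtain c where c: "c \<in> V" "c \<noteq> r" "par c = r" "v \<in> desc c" by (rule top_ancestor)
  define C where "C = {v \<in> V. h v = 1}"
  have wr: "w \<noteq> r" "w' \<noteq> r" using w par_root by auto
  have hc: "h c = 1" using c h_par h_root by simp
  have "w \<in> desc c" "w' \<in> desc c"
    using c w desc_par_mono[of w c] desc_par_mono[of w' c] by (auto simp: v_def)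
  then have sub: "desc w \<subseteq> desc c" "desc w' \<subseteq> desc c" by (simp_all add: desc_trans)
  have hw: "h w = Suc (h v)" "h w' = Suc (h v)" using h_par w wr by (auto simp: v_def)
  have hv: "h v \<ge> 1" using v h_eq_0_iff[of v] by (cases "h v") auto
  have dC: "desc x \<inter> desc y = {}" if "x \<in> C" "y \<in> C" "x \<noteq> y" for x y
    using that desc_disjoint by (auto simp: C_def)
  have dw: "desc w \<inter> desc w' = {}" using desc_disjoint w hw \<open>w \<noteq> w'\<close> by simp
  have finC: "finite C" using finite_V by (simp add: C_def)
  have "c \<in> C" using c hc by (simp add: C_def)
  define X where "X = insert w (insert w' (C - {c}))"
  have "card X \<le> card leaves"
  proof (rule antichain_le_leaves)
    show "X \<subseteq> V - {r}" using w wr h_root by (auto simp: X_def C_def)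
    have child_disj: "desc x \<inter> desc y = {}" if "x = w \<or> x = w'" "y \<in> C - {c}" for x y
      using dC[of c y] that sub \<open>c \<in> C\<close> by blast
    fix x y assume "x \<in> X" "y \<in> X" "x \<noteq> y"
    then consider "x \<in> C - {c}" "y \<in> C - {c}" | "x = w \<or> x = w'" "y \<in> C - {c}"
      | "y = w \<or> y = w'" "x \<in> C - {c}" | "x = w" "y = w'" | "x = w'" "y = w"
      unfolding X_def by blast
    then show "desc x \<inter> desc y = {}"
    proof cases
      case 1
      then show ?thesis using dC \<open>x \<noteq> y\<close> by simp
    next
      case 2
      then show ?thesis using child_disj by simp
    next
      case 3
      then show ?thesis using child_disj[of y x] by (simp add: Int_commute)
    qed (use dw in \<open>simp_all add: Int_commute\<close>)
  qed
  moreover have "w \<notin> C" "w' \<notin> C" using hw hv by (auto simp: C_def)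
  then have "card X = card C + 1"
    using \<open>w \<noteq> w'\<close> \<open>c \<in> C\<close> finC card_Suc_Diff1[of C c] by (simp add: X_def)
  ultimately show False using assms(1) by (simp add: C_def)
qed

end

section \<open>The balanced competitor\<close>

lemma card_bij_Collect:
  assumes "bij_betw f A B"
  shows "card {x \<in> A. P (f x)} = card {y \<in> B. P y}"
proof (rule bij_betw_same_card)
  show "bij_betw f {x \<in> A. P (f x)} {y \<in> B. P y}"
    using assms unfolding bij_betw_def inj_on_def by auto
qed

text \<open>Maximality compares trees over the type \<open>'a\<close> only, so the competitor is
  built on the given vertex set. The positive numbers of one residue class modulo
  \<open>2 * k\<close> form a leg, so each level is filled up to \<open>2 * k\<close> vertices
  before the next one begins.\<close>

lemma ex_balanced_tree:
  fixes V :: "'a set"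
  assumes V: "finite V" "card V = n" and k: "1 \<le> k" "2 * k \<le> n"
  obtains r par h where "rooted_tree V r par h" "tree_graph V r par \<in> odd_trees n k"
    "\<And>d. card {v \<in> V. h v > d} = card V - 1 - 2 * k * d"
proof -
  define m where "m = 2 * k"
  have m: "m \<ge> 2" "m \<le> n" "even m" using k by (auto simp: m_def)
  obtain idx where idx: "bij_betw idx V {0..<n}" using ex_bij_betw_finite_nat V by blast
  define g where "g = inv_into V idx"
  have g: "\<And>i. i < n \<Longrightarrow> g i \<in> V" "\<And>i. i < n \<Longrightarrow> idx (g i) = i"
    "\<And>v. v \<in> V \<Longrightarrow> g (idx v) = v" "\<And>v. v \<in> V \<Longrightarrow> idx v < n"
    using idx bij_betw_inv_into_right[OF idx] bij_betw_inv_into_left[OF idx]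
      bij_betwE[OF idx] bij_betwE[OF bij_betw_inv_into[OF idx]]
    by (auto simp: g_def)
  \<comment> \<open>in the numbering \<open>idx\<close> by \<open>0, \<dots>, n - 1\<close> the parent of \<open>i\<close> is the truncated difference
    \<open>i - m\<close>, and the depth of \<open>i\<close> is \<open>i / m\<close> rounded up\<close>
  define r where "r = g 0"
  define par where "par v = g (idx v - m)" for v
  define h where "h v = (idx v + m - 1) div m" for v
  have r: "r \<in> V" "idx r = 0" using g m by (auto simp: r_def)
  have r_iff: "v = r \<longleftrightarrow> idx v = 0" if "v \<in> V" for v using g(3)[OF that] r by (auto simp: r_def)
  have idx_par: "idx (par v) = idx v - m" if "v \<in> V" for v
    using g(4)[OF that] by (auto simp: par_def intro: g(2))
  interpret rooted_tree V r par h
  proof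
    show "finite V" "r \<in> V" using V r by auto
    show "par r = r" using r by (simp add: par_def r_def)
    show "h r = 0" using m r by (simp add: h_def)
    fix v assume v: "v \<in> V"
    show "par v \<in> V" using g(4)[OF v] by (auto simp: par_def intro: g(1))
    assume "v \<noteq> r"
    then have pos: "idx v > 0" using r_iff[OF v] by simp
    have "idx v + m - 1 = idx v - 1 + m" using pos by simp
    then have "h v = (idx v - 1 + m) div m" by (simp only: h_def)
    then have "h v = Suc ((idx v - 1) div m)" using m by (simp add: div_add_self2 del: diff_Suc_1)
    moreover have "(idx v - m + m - 1) div m = (idx v - 1) div m"
      using m by (cases "idx v \<ge> m") auto
    ultimately show "h v = Suc (h (par v))" by (simp add: h_def idx_par v)
  qed
  have above: "card {v \<in> V. h v > d} = card V - 1 - 2 * k * d" for d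
  proof -
    have "card {v \<in> V. h v > d} = card {i \<in> {0..<n}. (i + m - 1) div m > d}"
      unfolding h_def using card_bij_Collect[OF idx, of "\<lambda>i. (i + m - 1) div m > d"] by simp
    also have "{i \<in> {0..<n}. (i + m - 1) div m > d} = {m * d<..<n}"
    proof -
      have "(i + m - 1) div m > d \<longleftrightarrow> i > m * d" for i
      proof -
        have "(i + m - 1) div m > d \<longleftrightarrow> Suc d * m \<le> i + m - 1"
          using m by (simp add: Suc_le_eq[symmetric] less_eq_div_iff_mult_less_eq del: mult_Suc)
        also have "\<dots> \<longleftrightarrow> i > m * d" using m by (auto simp: mult.commute)
        finally show ?thesis .
      qed
      then have "{i \<in> {0..<n}. (i + m - 1) div m > d} = {i \<in> {0..<n}. i > m * d}"
        by (simp only:)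
      also have "\<dots> = {m * d<..<n}" by auto
      finally show ?thesis .
    qed
    finally show ?thesis by (simp add: V m_def)
  qed
  \<comment> \<open>Degrees are computed in the numbering: number \<open>j > 0\<close> has at most
    the child \<open>j + m\<close>, and the children of 0 are the numbers \<open>1, ..., m\<close>
    below \<open>n\<close>.\<close>
  have ch: "card (children v) = card {i \<in> {0..<n}. i \<noteq> 0 \<and> i - m = idx v}" if v: "v \<in> V" for v
  proof -
    have par_eq: "par w = v \<longleftrightarrow> idx w - m = idx v" if "w \<in> V" for w
      using idx_par[OF that] g(3)[OF par_in[OF that]] g(3)[OF v] by metis
    have "w \<in> V - {r} \<and> par w = v \<longleftrightarrow> w \<in> V \<and> idx w \<noteq> 0 \<and> idx w - m = idx v" for w
      by (cases "w \<in> V") (simp_all add: r_iff par_eq)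
    then have "children v = {w \<in> V. idx w \<noteq> 0 \<and> idx w - m = idx v}"
      by (simp only: children_def)
    then show ?thesis
      using card_bij_Collect[OF idx, of "\<lambda>i. i \<noteq> 0 \<and> i - m = idx v"] by simp
  qed
  define P where
    "P j \<longleftrightarrow> odd (card {i \<in> {0..<n}. i \<noteq> 0 \<and> i - m = j} + (if j = 0 then 0 else 1))" for j
  have "odd_vertices G = {v \<in> V. P (idx v)}"
    unfolding odd_vertices_def P_def
    by (rule Collect_cong, rule conj_cong) (simp_all only: tree_graph_simps out_degree_G ch r_iff)
  then have "card (odd_vertices G) = card {j \<in> {0..<n}. P j}"
    using card_bij_Collect[OF idx] by simp
  \<comment> \<open>For \<open>j > 0\<close> the degree is 1 at the end of a leg and 2 elsewhere.
    The root has degree \<open>min (n - 1) m\<close>, which is odd exactly if \<open>n = m\<close>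
    because \<open>m\<close> is even.\<close>
  also have "{j \<in> {0..<n}. P j} = {n - m..<n}"
  proof -
    have "P j \<longleftrightarrow> n \<le> j + m" if j: "0 < j" for j
    proof -
      have "{i \<in> {0..<n}. i \<noteq> 0 \<and> i - m = j} = (if j + m < n then {j + m} else {})"
        using j by auto
      then show ?thesis using j by (simp add: P_def)
    qed
    moreover have "P 0 \<longleftrightarrow> n = m"
    proof -
      have "{i \<in> {0..<n}. i \<noteq> 0 \<and> i - m = 0} = {0<..<min n (Suc m)}" by auto
      then have "card {i \<in> {0..<n}. i \<noteq> 0 \<and> i - m = 0} = min n (Suc m) - 1"
        by (simp only: card_greaterThanLessThan)
      also have "\<dots> = min (n - 1) m" by linarith
      finally have "card {i \<in> {0..<n}. i \<noteq> 0 \<and> i - m = 0} = min (n - 1) m" .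
      then have P0: "P 0 \<longleftrightarrow> odd (min (n - 1) m)" by (simp add: P_def)
      show ?thesis
      proof (cases "n = m")
        case True
        then show ?thesis using m P0 by simp
      next
        case False
        then have "min (n - 1) m = m" using m by simp
        then show ?thesis using m P0 False by simp
      qed
    qed
    ultimately have "P j \<longleftrightarrow> n \<le> j + m" for j using m by (cases "j = 0") auto
    then have "{j \<in> {0..<n}. P j} = {j \<in> {0..<n}. n \<le> j + m}" by (simp only:)
    also have "\<dots> = {n - m..<n}" by auto
    finally show ?thesis .
  qed
  finally have "card (odd_vertices G) = 2 * k" using m by (simp add: m_def)
  then have "G \<in> odd_trees n k" using simple_tree_G V by (simp add: odd_trees_def)
  then show ?thesis using that rooted_tree_axioms above by blast
qed

section \<open>Spiders\<close>

lemma digraph_isoI: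
  assumes "wf_digraph (with_proj G)" "bij_betw f (pverts G) (pverts H)"
    and "parcs H = (\<lambda>(x, y). (f x, f y)) ` parcs G"
  shows "digraph_iso (with_proj G) (with_proj H)"
proof -
  interpret pair_wf_digraph G using assms(1) by (simp add: wf_digraph_wp_iff)
  define F where "F = \<lparr>iso_verts = f, iso_arcs = \<lambda>(x, y). (f x, f y), iso_head = snd, iso_tail = fst\<rparr>"
  have inj: "inj_on f (pverts G)" using assms(2) by (simp add: bij_betw_def)
  have "inj_on (\<lambda>(x, y). (f x, f y)) (parcs G)"
    by (rule inj_onI) (use inj in \<open>auto dest: inj_onD wellformed'\<close>)
  then have "digraph_isomorphism F"
    using inj assms(1) unfolding digraph_isomorphism_def F_def by auto
  moreover have "with_proj H = app_iso F (with_proj G)"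
    using assms(2,3) by (simp add: with_proj_def app_iso_def F_def bij_betw_def)
  ultimately show ?thesis unfolding digraph_iso_def by blast
qed

text \<open>Every arc joins a vertex to its parent in one of the two directions, so commuting with
  the parent functions is enough.\<close>

lemma tree_graph_iso:
  assumes "rooted_tree V r par h" "bij_betw f V W"
    and "\<And>v. v \<in> V \<Longrightarrow> v \<noteq> r \<Longrightarrow> par' (f v) = f (par v)"
  shows "digraph_iso (with_proj (tree_graph V r par)) (with_proj (tree_graph W (f r) par'))"
proof (rule digraph_isoI)
  interpret rooted_tree V r par h by fact
  show "wf_digraph (with_proj G)" by (rule pg.wf_digraph_axioms)
  show "bij_betw f (pverts G) (pverts (tree_graph W (f r) par'))" using assms(2) by simp
  have "W - {f r} = f ` (V - {r})"
    using assms(2) root_in unfolding bij_betw_def inj_on_def by auto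
  moreover have "(\<lambda>v. (f v, par' (f v))) ` (V - {r}) = (\<lambda>v. (f v, f (par v))) ` (V - {r})"
    "(\<lambda>v. (par' (f v), f v)) ` (V - {r}) = (\<lambda>v. (f (par v), f v)) ` (V - {r})"
    using assms(3) by (auto intro!: image_cong)
  ultimately show "parcs (tree_graph W (f r) par') = (\<lambda>(x, y). (f x, f y)) ` parcs G"
    by (simp only: tree_graph_simps image_Un image_image prod.case)
qed

text \<open>One step towards the centre: \<open>spider_vertex\<close> merges position 0 of all legs,
  and truncated subtraction fixes the centre.\<close>

definition spider_parent :: "nat \<times> nat \<Rightarrow> nat \<times> nat" where
  "spider_parent v = spider_vertex (fst v) (snd v - 1)"

lemma pverts_spider: "pverts (spider m l) = insert (0, 0) (SIGMA i:{..<m}. {1..l i})"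
proof -
  have "{spider_vertex i j | i j. i < m \<and> j \<le> l i} \<subseteq> insert (0, 0) (SIGMA i:{..<m}. {1..l i})"
    by (auto simp: spider_vertex_def)
  moreover have "(SIGMA i:{..<m}. {1..l i}) \<subseteq> {spider_vertex i j | i j. i < m \<and> j \<le> l i}"
  proof
    fix x assume "x \<in> (SIGMA i:{..<m}. {1..l i})"
    then obtain i j where "x = (i, j)" "i < m" "1 \<le> j" "j \<le> l i" by auto
    moreover from this have "x = spider_vertex i j" by (simp add: spider_vertex_def)
    ultimately show "x \<in> {spider_vertex i j | i j. i < m \<and> j \<le> l i}" by blast
  qed
  ultimately show ?thesis unfolding spider_def Let_def by auto
qed

lemma spider_tree_graph: "spider m l = tree_graph (pverts (spider m l)) (0, 0) spider_parent"
proof -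
  define L where "L = (SIGMA i:{..<m}. {1..l i})"
  have L: "pverts (spider m l) - {(0, 0)} = L" by (auto simp: pverts_spider L_def)
  \<comment> \<open>An edge of a leg is named by its outer end \<open>(i, Suc j)\<close>, which is
    the child.\<close>
  have conv:
    "{(spider_vertex i j, spider_vertex i (Suc j)) | i j. i < m \<and> j < l i}\<inverse> =
       (\<lambda>v. (v, spider_parent v)) ` L" (is "?A\<inverse> = _")
  proof (intro equalityI subrelI)
    fix x y assume "(x, y) \<in> ?A\<inverse>"
    then obtain i j where "y = spider_vertex i j" "x = spider_vertex i (Suc j)" "i < m" "j < l i"
      by auto
    then show "(x, y) \<in> (\<lambda>v. (v, spider_parent v)) ` L"
      by (intro image_eqI[of _ _ "(i, Suc j)"])
        (auto simp: spider_vertex_def spider_parent_def L_def)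
  next
    fix x y assume "(x, y) \<in> (\<lambda>v. (v, spider_parent v)) ` L"
    then obtain i j where "x = (i, Suc j)" "y = spider_vertex i j" "i < m" "j < l i"
      by (auto simp: spider_parent_def L_def Suc_le_eq gr0_conv_Suc)
    then show "(x, y) \<in> ?A\<inverse>" by (auto simp: spider_vertex_def)
  qed
  have "?A = (?A\<inverse>)\<inverse>" by simp
  also have "\<dots> = (\<lambda>v. (spider_parent v, v)) ` L" unfolding conv by auto
  finally have A: "?A = (\<lambda>v. (spider_parent v, v)) ` L" .
  have "parcs (spider m l) = ?A \<union> ?A\<inverse>" by (simp add: spider_def Let_def)
  also have "\<dots> = (\<lambda>v. (v, spider_parent v)) ` L \<union> (\<lambda>v. (spider_parent v, v)) ` L"
    by (subst conv, subst A, rule Un_commute)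
  finally show ?thesis
    by (intro pair_pre_digraph.equality) (simp_all only: tree_graph_simps L, simp)
qed

lemma spider_rooted_tree: "rooted_tree (pverts (spider m l)) (0, 0) spider_parent snd"
  by unfold_locales (auto simp: pverts_spider spider_parent_def spider_vertex_def)

lemma wf_spider: "wf_digraph (with_proj (spider m l))"
proof -
  interpret rooted_tree "pverts (spider m l)" "(0, 0)" spider_parent snd
    by (rule spider_rooted_tree)
  show ?thesis by (subst spider_tree_graph) (rule pg.wf_digraph_axioms)
qed

text \<open>The legs are laid out on a line: leg 1 reversed at the positions below
  \<open>l 1\<close>, the centre at \<open>l 1\<close>, leg 0 beyond it. The one-legged spider has
  its common vertex at an end of the path.\<close>

lemma spider_two_iso_path:
  "digraph_iso (with_proj (spider 2 l)) (with_proj (spider 1 (\<lambda>_. l 0 + l 1)))"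
proof (rule digraph_isoI)
  let ?N = "l 0 + l 1"
  define f :: "nat \<times> nat \<Rightarrow> nat \<times> nat"
    where "f = (\<lambda>(i, j). (0, if i = 0 then l 1 + j else l 1 - j))"
  define F where "F = (\<lambda>(x, y). (f x, f y))"
  define E :: "nat \<Rightarrow> (nat \<times> nat) \<times> (nat \<times> nat)" where "E j = ((0, j), (0, Suc j))" for j
  define A where
    "A m l = (\<Union>i<m. (\<lambda>j. (spider_vertex i j, spider_vertex i (Suc j))) ` {..<l i})"
    for m :: nat and l :: "nat \<Rightarrow> nat"
  show "wf_digraph (with_proj (spider 2 l))" by (rule wf_spider)
  have two: "pverts (spider 2 l) = Pair 0 ` {..l 0} \<union> Pair 1 ` {1..l 1}"
  proof (rule set_eqI)
    fix x :: "nat \<times> nat"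
    obtain i j where "x = (i, j)" by (cases x)
    then show "x \<in> pverts (spider 2 l) \<longleftrightarrow> x \<in> Pair 0 ` {..l 0} \<union> Pair 1 ` {1..l 1}"
      by (cases "i = 0"; cases "i = 1") (auto simp: pverts_spider)
  qed
  show "bij_betw f (pverts (spider 2 l)) (pverts (spider 1 (\<lambda>_. ?N)))"
  proof (rule bij_betw_imageI)
    show "inj_on f (pverts (spider 2 l))"
      by (rule inj_on_inverseI[of _ "\<lambda>(_, x). if l 1 \<le> x then (0, x - l 1) else (1, l 1 - x)"])
        (auto simp: two f_def)
    show "f ` pverts (spider 2 l) = pverts (spider 1 (\<lambda>_. ?N))"
    proof (intro equalityI subsetI)
      fix x assume "x \<in> f ` pverts (spider 2 l)"
      then show "x \<in> pverts (spider 1 (\<lambda>_. ?N))"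
        unfolding two by (auto simp: pverts_spider f_def)
    next
      fix x assume "x \<in> pverts (spider 1 (\<lambda>_. ?N))"
      then obtain j where j: "x = (0, j)" "j \<le> ?N" by (auto simp: pverts_spider)
      show "x \<in> f ` pverts (spider 2 l)"
      proof (cases "l 1 \<le> j")
        case True
        then show ?thesis
          using j by (intro image_eqI[of _ _ "(0, j - l 1)"]) (auto simp: two f_def)
      next
        case False
        then show ?thesis
          using j by (intro image_eqI[of _ _ "(1, l 1 - j)"]) (auto simp: two f_def)
      qed
    qed
  qed
  have arcs: "parcs (spider m l) = A m l \<union> (A m l)\<inverse>" for m l
  proof -
    have "{(spider_vertex i j, spider_vertex i (Suc j)) | i j. i < m \<and> j < l i} = A m l"
      unfolding A_def by blast
    then show ?thesis by (simp add: spider_def Let_def)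
  qed
  have E: "(spider_vertex 0 j, (0, Suc j)) = E j" for j
    by (simp add: E_def spider_vertex_def)
  have "{..<1} = {0 :: nat}" "{..<2} = {0, 1 :: nat}" by auto
  then have A1: "A 1 (\<lambda>_. ?N) = E ` {..<?N}"
    and A2: "A 2 l = E ` {..<l 0} \<union> (\<lambda>j. (spider_vertex 1 j, (1, Suc j))) ` {..<l 1}"
    by (simp_all add: A_def E spider_vertex_def[of _ "Suc _"])
  have "F ` E ` {..<l 0} = E ` (+) (l 1) ` {..<l 0}"
    unfolding image_image by (simp add: F_def f_def E_def)
  also have "(+) (l 1) ` {..<l 0} = {l 1..<?N}"
    using image_add_atLeastLessThan[of "l 1" 0 "l 0"] by (simp add: lessThan_atLeast0 add.commute)
  finally have F0: "F ` E ` {..<l 0} = E ` {l 1..<?N}" .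
  \<comment> \<open>Leg 1 is laid out backwards, so its outward arcs become converses of arcs
    \<open>E j\<close>; adding all converses removes the difference.\<close>
  have "F ` (\<lambda>j. (spider_vertex 1 j, (1, Suc j))) ` {..<l 1} =
      (\<lambda>j. ((0, Suc (l 1 - Suc j)), (0, l 1 - Suc j))) ` {..<l 1}"
    unfolding image_image
    by (intro image_cong refl) (auto simp: F_def f_def spider_vertex_def)
  also have "\<dots> = (\<lambda>j. ((0, Suc j), (0, j))) ` (\<lambda>j. l 1 - Suc j) ` {..<l 1}"
    unfolding image_image ..
  also have "(\<lambda>j. l 1 - Suc j) ` {..<l 1} = {..<l 1}"
  proof (intro equalityI subsetI)
    fix x assume "x \<in> {..<l 1}"
    then show "x \<in> (\<lambda>j. l 1 - Suc j) ` {..<l 1}"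
      by (intro image_eqI[of _ _ "l 1 - Suc x"]) auto
  qed auto
  also have "(\<lambda>j. ((0, Suc j), (0, j))) ` {..<l 1} = (E ` {..<l 1})\<inverse>"
    by (auto simp: E_def)
  finally have F1: "F ` (\<lambda>j. (spider_vertex 1 j, (1, Suc j))) ` {..<l 1} = (E ` {..<l 1})\<inverse>" .
  have F2: "F ` A 2 l = E ` {l 1..<?N} \<union> (E ` {..<l 1})\<inverse>"
    unfolding A2 image_Un F0 F1 ..
  have "F ` (A 2 l \<union> (A 2 l)\<inverse>) = F ` A 2 l \<union> (F ` A 2 l)\<inverse>"
    by (force simp: F_def)
  also have "\<dots> = (E ` {..<l 1} \<union> E ` {l 1..<?N}) \<union> (E ` {..<l 1} \<union> E ` {l 1..<?N})\<inverse>"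
    unfolding F2 converse_Un converse_converse by (simp only: Un_ac)
  also have "E ` {..<l 1} \<union> E ` {l 1..<?N} = E ` {..<?N}"
    unfolding image_Un[symmetric] by (rule arg_cong[of _ _ "\<lambda>X. E ` X"]) auto
  finally show "parcs (spider 1 (\<lambda>_. ?N)) = (\<lambda>(x, y). (f x, f y)) ` parcs (spider 2 l)"
    unfolding arcs A1 F_def by simp
qed

section \<open>From level sizes to the balanced spider\<close>

context rooted_tree
begin

text \<open>Without branching below the root, upward steps can be undone one at a time;
  \<open>i < h x\<close> keeps the common ancestor off the root.\<close>

lemma iter_inj:
  assumes "\<And>w w'. w \<in> V \<Longrightarrow> w' \<in> V \<Longrightarrow> par w = par w' \<Longrightarrow> par w \<noteq> r \<Longrightarrow> w = w'"
    and "x \<in> V" "y \<in> V" "(par ^^ i) x = (par ^^ i) y" "i < h x"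
  shows "x = y"
  using assms(2-)
proof (induction i arbitrary: x y)
  case 0
  then show ?case by simp
next
  case (Suc i)
  have "h (par x) = h x - 1" using Suc.prems h_par_eq by simp
  then have "i < h (par x)" using Suc.prems by simp
  then have "par x = par y"
    using Suc.IH[of "par x" "par y"] Suc.prems by (simp add: par_in funpow_swap1)
  moreover have "par x \<noteq> r" using \<open>i < h (par x)\<close> h_root by auto
  ultimately show ?case using assms(1) Suc.prems by blast
qed

text \<open>A vertex is named by the child of the root above it, which selects the leg, and by its
  depth. The level sizes give \<open>m\<close> legs, \<open>t\<close> of which reach depth
  \<open>q + 1\<close> and the others depth \<open>q\<close>.\<close>

lemma iso_balanced_spider:
  assumes m: "1 \<le> m" "m \<le> card V - 1"
    and above: "\<And>d. card {v \<in> V. h v > d} = card V - 1 - m * d"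
    and uniq: "\<And>w w'. w \<in> V \<Longrightarrow> w' \<in> V \<Longrightarrow> par w = par w' \<Longrightarrow> par w \<noteq> r \<Longrightarrow> w = w'"
  defines "q \<equiv> (card V - 1) div m" and "t \<equiv> card V - 1 - m * ((card V - 1) div m)"
  shows "digraph_iso (with_proj G) (with_proj (spider m (\<lambda>i. if i < t then q + 1 else q)))"
proof -
  define n where "n = card V"
  define len where "len i = (if i < t then q + 1 else q)" for i
  have n: "n \<ge> 1" "n - 1 = m * q + t" "t < m"
    using m mod_less_divisor[of m "card V - 1"]
    by (auto simp: n_def q_def t_def minus_mult_div_eq_mod)
  define top where "top v = (par ^^ (h v - 1)) v" for v
  define C where "C = {v \<in> V. h v = 1}"
  define B where "B = {v \<in> V. h v > q}"
  have fin: "finite C" "finite B" using finite_V by (simp_all add: C_def B_def)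
  have cardB: "card B = t" using above[of q] n by (simp add: B_def n_def)
  \<comment> \<open>As \<open>t < m\<close>, \<open>m * (q + 1)\<close> exceeds
    \<open>n - 1\<close>, so nothing lies deeper than \<open>q + 1\<close> and \<open>B\<close> is
    exactly that level.\<close>
  have h_le: "h v \<le> q + 1" if "v \<in> V" for v
  proof (rule ccontr)
    assume "\<not> h v \<le> q + 1"
    then have "v \<in> {v \<in> V. h v > q + 1}" using that by simp
    then have "card {v \<in> V. h v > q + 1} > 0" using finite_V by (auto simp: card_gt_0_iff)
    then show False using above[of "q + 1"] n by (simp add: n_def algebra_simps)
  qed
  \<comment> \<open>The first level is the difference of the counts for \<open>d = 0\<close> and
    \<open>d = 1\<close>; \<open>m \<le> card V - 1\<close> avoids truncation.\<close>
  have cardC: "card C = m"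
  proof -
    have "{v \<in> V. h v > 0} = C \<union> {v \<in> V. h v > 1}" by (auto simp: C_def)
    then have "card {v \<in> V. h v > 0} = card C + card {v \<in> V. h v > 1}"
      using finite_V by (simp only:) (rule card_Un_disjoint, auto simp: C_def)
    then show ?thesis using above[of 0] above[of 1] m by simp
  qed
  have top_C: "top v \<in> C" if "v \<in> V" "v \<noteq> r" for v
  proof -
    have "h v \<noteq> 0" using that h_eq_0_iff by blast
    then show ?thesis
      using that h_iter[of v "h v - 1"] by (simp add: C_def top_def iter_in)
  qed
  have top_inj: "v = w" if "v \<in> V" "w \<in> V" "top v = top w" "h v = h w" "v \<noteq> r" for v w
  proof (rule iter_inj[OF uniq])
    show "(par ^^ (h v - 1)) v = (par ^^ (h v - 1)) w" using that by (simp add: top_def)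
    show "h v - 1 < h v" using that h_eq_0_iff[of v] by (cases "h v") auto
  qed (use that in auto)
  have hB: "h v = q + 1" "v \<in> V" "v \<noteq> r" if "v \<in> B" for v
    using that h_le[of v] h_root by (auto simp: B_def)
  have "inj_on top B" by (rule inj_onI) (use hB top_inj in metis)
  then have cardT: "card (top ` B) = t" using cardB by (simp add: card_image)
  have TC: "top ` B \<subseteq> C" using top_C hB by auto
  \<comment> \<open>The long legs, those meeting \<open>B\<close>, get the numbers below
    \<open>t\<close>, as in \<open>balanced_spider\<close>.\<close>
  obtain g where g: "bij_betw g C {..<m}" "\<And>c. c \<in> C \<Longrightarrow> c \<in> top ` B \<longleftrightarrow> g c < t"
  proof -
    obtain g1 where g1: "bij_betw g1 (top ` B) {..<t}"
      using finite_same_card_bij[of "top ` B" "{..<t}"] fin cardT by auto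
    obtain g2 where g2: "bij_betw g2 (C - top ` B) {t..<m}"
      using finite_same_card_bij[of "C - top ` B" "{t..<m}"] fin cardT cardC TC
      by (auto simp: card_Diff_subset)
    define g where "g c = (if c \<in> top ` B then g1 c else g2 c)" for c
    have "bij_betw g (top ` B \<union> (C - top ` B)) ({..<t} \<union> {t..<m})"
      unfolding g_def by (rule bij_betw_disjoint_Un[OF g1 g2]) auto
    moreover have "top ` B \<union> (C - top ` B) = C" "{..<t} \<union> {t..<m} = {..<m}" using TC n by auto
    moreover have "c \<in> top ` B \<longleftrightarrow> g c < t" if "c \<in> C" for c
    proof (cases "c \<in> top ` B")
      case True
      then have "g1 c \<in> {..<t}" using bij_betwE[OF g1] by blast
      then show ?thesis using True by (simp add: g_def)
    next
      case False
      then have "g2 c \<in> {t..<m}" using bij_betwE[OF g2] that by blast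
      then show ?thesis using False by (simp add: g_def)
    qed
    ultimately show ?thesis using that[of g] by simp
  qed
  define W where "W = pverts (spider m len)"
  define f where "f v = spider_vertex (g (top v)) (h v)" for v
  have f_root: "f r = (0, 0)" by (simp add: f_def spider_vertex_def h_root)
  have f_eq: "f v = (g (top v), h v)" "h v \<ge> 1" if "v \<in> V" "v \<noteq> r" for v
    using h_eq_0_iff[OF that(1)] that by (auto simp: f_def spider_vertex_def)
  have f_zero: "v = r" if "v \<in> V" "f v = (0, 0)" for v
    using f_eq[of v] that by (cases "v = r") auto
  have "inj_on f V"
  proof (rule inj_onI)
    fix v w assume vw: "v \<in> V" "w \<in> V" "f v = f w"
    show "v = w"
    proof (cases "v = r \<or> w = r")
      case True
      then have "f v = (0, 0)" "f w = (0, 0)" using vw f_root by auto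
      then show ?thesis using vw f_zero by blast
    next
      case False
      then have "g (top v) = g (top w)" "h v = h w" using vw f_eq(1) by auto
      then show ?thesis
        using vw False top_inj[of v w] top_C[of v] top_C[of w] g(1)
        by (auto simp: bij_betw_def dest: inj_onD)
    qed
  qed
  moreover have "f ` V \<subseteq> W"
  proof
    fix x assume "x \<in> f ` V"
    then obtain v where v: "v \<in> V" "x = f v" by auto
    show "x \<in> W"
    proof (cases "v = r")
      case True
      then show ?thesis using v f_root by (simp add: W_def pverts_spider)
    next
      case False
      have c: "top v \<in> C" using top_C v False by simp
      have "h v \<le> len (g (top v))"
      proof (cases "h v \<le> q")
        case False
        then have "v \<in> B" using v by (simp add: B_def)
        then have "g (top v) < t" using g(2)[OF c] by blast
        then show ?thesis using h_le[OF v(1)] by (simp add: len_def)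
      qed (simp add: len_def)
      moreover have "g (top v) < m" using c bij_betwE[OF g(1)] by auto
      ultimately show ?thesis
        using v f_eq[OF v(1) False] by (simp add: W_def pverts_spider)
    qed
  qed
  \<comment> \<open>The spider has \<open>1 + m * q + t = n\<close> vertices, so the injection
    \<open>f\<close> into \<open>W\<close> is onto by counting.\<close>
  moreover have "finite W" "card W = card V"
  proof -
    have "{..<m} \<inter> {i. i < t} = {..<t}" using n by auto
    have "(\<Sum>i<m. len i) = (\<Sum>i<m. q + (if i < t then 1 else 0))"
      by (intro sum.cong) (auto simp: len_def)
    also have "\<dots> = m * q + t"
      using \<open>{..<m} \<inter> {i. i < t} = {..<t}\<close> by (simp add: sum.distrib sum.If_cases)
    finally have "card (SIGMA i:{..<m}. {1..len i}) = n - 1" using n by (simp add: card_SigmaI)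
    then show "finite W" "card W = card V" using n by (auto simp: W_def pverts_spider n_def)
  qed
  ultimately have bij: "bij_betw f V W"
    by (metis bij_betw_def card_image card_subset_eq)
  have "digraph_iso (with_proj G) (with_proj (tree_graph W (f r) spider_parent))"
  proof (rule tree_graph_iso[OF rooted_tree_axioms bij])
    fix v assume v: "v \<in> V" "v \<noteq> r"
    have hp: "h v = Suc (h (par v))" using h_par v by simp
    show "spider_parent (f v) = f (par v)"
    proof (cases "par v = r")
      case True
      then show ?thesis
        using f_eq[OF v] f_root hp h_root by (simp add: spider_parent_def spider_vertex_def)
    next
      case False
      then have "h (par v) \<noteq> 0" using h_eq_0_iff[OF par_in[OF v(1)]] by simp
      then obtain j where j: "h (par v) = Suc j" by (cases "h (par v)") auto
      have "top (par v) = top v" using hp j by (simp add: top_def funpow_swap1)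
      then show ?thesis using f_eq(1)[OF v] hp by (simp add: spider_parent_def f_def)
    qed
  qed
  then have "digraph_iso (with_proj G) (with_proj (spider m len))"
    by (simp only: W_def f_root spider_tree_graph[symmetric])
  moreover have "len = (\<lambda>i. if i < t then q + 1 else q)" by (rule ext) (rule len_def)
  ultimately show ?thesis by (simp only:)
qed

end

section \<open>Comparison of a maximal tree with the competitor\<close>

theorem theorem3p1:
  fixes T :: "'a pair_pre_digraph" and n k :: nat
  assumes "1 \<le> k" and "k \<le> n div 2"
    and "T \<in> odd_trees n k"
    and "\<And>T' :: 'a pair_pre_digraph. T' \<in> odd_trees n k \<Longrightarrow> mostar_index T' \<le> mostar_index T"
  shows "digraph_iso (with_proj T) (with_proj (balanced_spider n (2 * k)))"
proof -
  define V where "V = pverts T"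
  have T: "simple_tree T" "card V = n" "card (odd_vertices T) = 2 * k"
    using assms(3) by (auto simp: odd_trees_def V_def)
  have k: "2 * k \<le> n" using assms(2) by linarith
  obtain r0 par0 h0 where T0: "rooted_tree V r0 par0 h0" "T = tree_graph V r0 par0"
    using simple_tree_rooted[OF T(1)] unfolding V_def by metis
  \<comment> \<open>Re-rooted at a centroid, where the Mostar index is determined by the depth
    sum.\<close>
  obtain r par h where R: "rooted_tree V r par h" and T_eq: "tree_graph V r par = T"
    and mo: "mostar_index T = int n * (int n - 1) - 2 * int (\<Sum>v\<in>V. h v)"
    using rooted_tree.centroid[OF T0(1)] T0(2) T(2) by metis
  interpret rooted_tree V r par h by (rule R)
  obtain s par' h' where S: "rooted_tree V s par' h'" "tree_graph V s par' \<in> odd_trees n k"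
    and S_above: "\<And>d. card {v \<in> V. h' v > d} = card V - 1 - 2 * k * d"
    using ex_balanced_tree[OF finite_V T(2) assms(1) k] by metis
  interpret S: rooted_tree V s par' h' by (rule S(1))
  \<comment> \<open>For the competitor the lower bound suffices; maximality of \<open>T\<close> then
    becomes an inequality between the depth sums.\<close>
  have "int n * (int n - 1) - 2 * int (\<Sum>v\<in>V. h' v) \<le> mostar_index T"
    using S.mostar_index_ge assms(4)[OF S(2)] T(2) by simp
  then have sum_le: "(\<Sum>v\<in>V. h v) \<le> (\<Sum>v\<in>V. h' v)" unfolding mo by linarith
  have leaves_le: "card leaves \<le> 2 * k" using card_leaves_le T_eq T(3) by simp
  \<comment> \<open>The competitor attains the least depth sum possible with at most
    \<open>2 * k\<close> leaves, so \<open>T\<close> has the same level sizes.\<close>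
  have above: "card {v \<in> V. h v > d} = card V - 1 - 2 * k * d" for d
  proof (rule balanced_if_sum_le)
    show "1 \<le> 2 * k" using assms(1) by simp
    fix N assume "card V \<le> N"
    then show "(\<Sum>v\<in>V. h v) \<le> (\<Sum>d<N. card V - 1 - 2 * k * d)"
      using S.sum_h_balanced[of "2 * k" N] S_above sum_le assms(1) by simp
  qed (rule leaves_le)
  show ?thesis
  proof (cases "2 * k = n")
    case True
    \<comment> \<open>Here all depths are at most 1 and \<open>T\<close> is a star with
      \<open>n - 1\<close> legs, so \<open>iso_balanced_spider\<close> is applied with
      \<open>m = n - 1\<close>; the value \<open>2 * k\<close> would exceed
      \<open>card V - 1\<close>.\<close>
    have h_le: "h v \<le> 1" if "v \<in> V" for v
    proof (rule ccontr)
      assume "\<not> h v \<le> 1"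
      then have "card {v \<in> V. h v > 1} > 0" using finite_V that by (auto simp: card_gt_0_iff)
      then show False using above[of 1] True T(2) by simp
    qed
    have "digraph_iso (with_proj G) (with_proj (spider (n - 1)
      (\<lambda>i. if i < card V - 1 - (n - 1) * ((card V - 1) div (n - 1))
           then (card V - 1) div (n - 1) + 1 else (card V - 1) div (n - 1))))"
    proof (rule iso_balanced_spider)
      show "1 \<le> n - 1" "n - 1 \<le> card V - 1" using assms(1) k T(2) by auto
      show "card {v \<in> V. h v > d} = card V - 1 - (n - 1) * d" for d
      proof (cases "d = 0")
        case True
        then show ?thesis using above[of 0] by simp
      next
        case False
        then have "{v \<in> V. h v > d} = {}" using h_le by fastforce
        then have "card {v \<in> V. h v > d} = 0" by (simp only: card.empty)
        then show ?thesis using False T(2) by (cases d) auto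
      qed
      show "w = w'" if "w \<in> V" "w' \<in> V" "par w = par w'" "par w \<noteq> r" for w w'
      proof -
        have "w \<noteq> r" "h (par w) \<noteq> 0"
          using that par_root h_eq_0_iff[OF par_in[OF that(1)]] by auto
        then show ?thesis using h_par[OF that(1)] h_le[OF that(1)] by simp
      qed
    qed
    moreover have "(n - 1) div (n - 1) = 1" using assms(1) k by simp
    ultimately show ?thesis
      using T(2) T_eq True by (simp add: balanced_spider_def star_graph_def)
  next
    case False
    then have kn: "2 * k \<le> n - 1" using k by linarith
    \<comment> \<open>The first level has exactly \<open>2 * k\<close> vertices, at least as many as
      there are leaves, so nothing branches below the root.\<close>
    have "{v \<in> V. h v > 0} = {v \<in> V. h v = 1} \<union> {v \<in> V. h v > 1}" by auto
    then have "card {v \<in> V. h v > 0} = card {v \<in> V. h v = 1} + card {v \<in> V. h v > 1}"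
      using finite_V by (simp only:) (rule card_Un_disjoint, auto)
    moreover have "card {v \<in> V. h v > 0} = n - 1" using above[of 0] T(2) by simp
    moreover have "card {v \<in> V. h v > 1} = n - 1 - 2 * k" using above[of 1] T(2) by simp
    ultimately have "card {v \<in> V. h v = 1} = 2 * k" using kn by linarith
    then have "card leaves \<le> card {v \<in> V. h v = 1}" using leaves_le by (simp only:)
    note uniq = unique_child[OF this]
    define q t where "q = (n - 1) div (2 * k)" and "t = n - 1 - 2 * k * q"
    have iso: "digraph_iso (with_proj T) (with_proj (spider (2 * k) (\<lambda>i. if i < t then q + 1 else q)))"
      unfolding q_def t_def T(2)[symmetric] T_eq[symmetric]
      by (rule iso_balanced_spider[OF _ _ above uniq]) (use assms(1) kn T(2) in auto)
    \<comment> \<open>The remaining branches of \<open>balanced_spider\<close>: for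
      \<open>2 * k = n - 1\<close> all legs have length 1, for \<open>k = 1\<close> the two legs are
      joined into a path.\<close>
    consider "2 * k = n - 1" | "2 * k \<noteq> n - 1" "2 * k = 2" | "2 * k \<noteq> n - 1" "2 * k \<noteq> 2"
      by blast
    then show ?thesis
    proof cases
      case 1
      then have "q = 1" "t = 0" using assms(1) by (simp_all add: q_def t_def)
      then show ?thesis using iso 1 by (simp add: balanced_spider_def star_graph_def)
    next
      case 2
      define l where "l i = (if i < t then q + 1 else q)" for i
      have "q = (n - 1) div 2" "t = n - 1 - 2 * q" using 2 by (simp_all add: q_def t_def)
      then have "n - 1 = 2 * q + t" "t = 0 \<or> t = 1" by linarith+
      then have "l 0 + l 1 = n - 1" by (auto simp: l_def)
      then have "digraph_iso (with_proj (spider 2 l)) (with_proj (path_graph n))"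
        using spider_two_iso_path[of l] by (simp add: path_graph_def)
      moreover have "digraph_iso (with_proj T) (with_proj (spider 2 l))"
        using iso unfolding 2(2) l_def[abs_def] .
      ultimately have "digraph_iso (with_proj T) (with_proj (path_graph n))"
        using digraph_iso_trans by blast
      then show ?thesis using 2 False by (simp add: balanced_spider_def)
    next
      case 3
      then have "balanced_spider n (2 * k) = spider (2 * k) (\<lambda>i. if i < t then q + 1 else q)"
        using False unfolding balanced_spider_def q_def t_def Let_def by simp
      then show ?thesis using iso by simp
    qed
  qed
qed

end
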